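(* Let $A=X\cup Y$ be a partition of the set of options into two disjoint non-empty sets. If $$v_{xy}=1\quad(\text{and therefore } v_{yx}=0)\qquad\text{for all } x\in X,\ y\in Y, \tag{i}$$ then $$\sum_{x\in X}R_x=|X|\,(|X|+1)/2. \tag{ii}$$ If the individual preferences are transitive, then the converse implication (ii) $\Rightarrow$ (i) holds too.
   Context: Let $A$ be a finite set of $N$ options and $\Pi=\{(x,y)\in A\times A : x\neq y\}$; a pair $(x,y)$ is written $xy$. Let $\Omega=\{v\in[0,1]^{\Pi} : v_{xy}+v_{yx}\le 1 \text{ for all } xy\in\Pi\}$; its elements are called Llull matrices. For $v\in\Omega$ put $t_{xy}=v_{xy}+v_{yx}$ (turnouts). Individual preferences: the collective Llull matrix is $v=\sum_k\alpha_k v^k$ (finite sum), where $\alpha_k>0$, $\sum_k\alpha_k=1$, are the relative frequencies of the individual votes $v^k\in\Omega$. In the transitive case each individual vote is a binary relation $\rho_k\subseteq\Pi$, with $v^k_{xy}=1$ if $xy\in\rho_k$ and $yx\notin\rho_k$ (strict preference), $v^k_{xy}=1/2$ if both $xy,yx\in\rho_k$ (tie), and $v^k_{xy}=0$ otherwise; "the individual preferences are transitive" means that each $\rho_k$ is transitive ($xy,yz\in\rho_k$ and $x\ne z$ imply $xz\in\rho_k$). CLC procedure applied to $v\in\Omega$: (1) Indirect scores: $v^*_{xy}=\max\min_{0\le i<n} v_{x_ix_{i+1}}$, the maximum being over all paths $x_0x_1\dots x_n$ ($n\ge1$, consecutive elements distinct) in $A$ with $x_0=x$, $x_n=y$. Indirect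 margins: $m^{\kappa}_{xy}=v^*_{xy}-v^*_{yx}$. (2) Indirect comparison relation: $\kappa=\{xy\in\Pi : m^{\kappa}_{xy}>0\}$ (it is transitive). An admissible order is any strict total order $\xi\subseteq\Pi$ on $A$ with $\kappa\subseteq\xi$. Fix an admissible order $\xi$. Write $x\succ_\xi y$ for $xy\in\xi$, and $x\succeq_\xi y$ for ($xy\in\xi$ or $x=y$). For $x$ not last in $\xi$, $x'$ denotes the immediate successor of $x$ in $\xi$ (the element following $x$). (3) For each non-last $x$: $m^{\sigma}_{xx'}=\min\{m^{\kappa}_{pq} : p\succeq_\xi x,\ x'\succeq_\xi q\}$. (4) $(t^{\sigma}_{xy})$ is the unique minimizer of $\sum_{x}\sum_{y\neq x}(\tau_{xy}-t_{xy})^2$ over all $\tau\in\mathbb{R}^{\Pi}$ satisfying: $\tau_{xy}=\tau_{yx}$ for all $xy\in\Pi$; $m^{\sigma}_{xx'}\le\tau_{xx'}\le1$ for all non-last $x$; and $0\le\tau_{xz}-\tau_{x'z}\le m^{\sigma}_{xx'}$ for all non-last $x$ and all $z\notin\{x,x'\}$. (5) Projected scores: $v^{\pi}_{xx'}=(t^{\sigma}_{xx'}+m^{\sigma}_{xx'})/2$, $v^{\pi}_{x'x}=(t^{\sigma}_{xx'}-m^{\sigma}_{xx'})/2$, and for $x\succ_\xi y$: $v^{\pi}_{xy}=\max\{v^{\pi}_{pp'} : x\succeq_\xi p\succ_\xi y\}$, $v^{\pi}_{yx}=\min\{v^{\pi}_{p'p} : x\succeq_\xi p\succ_\xi y\}$.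 (6) Rank-like rates: $R_x=N-\sum_{y\neq x}v^{\pi}_{xy}$. The projected scores and rank-like rates do not depend on the choice of the admissible order $\xi$, so they are functions of $v$. *)

theory Defs
  imports Complex_Main
begin

text \<open>
  Matrices indexed by ordered pairs of distinct options are functions \<open>'a \<Rightarrow> 'a \<Rightarrow> real\<close>; only
  their values on \<open>pairs A\<close> are meaningful, and nothing below depends on the other values.
\<close>

definition pairs :: "'a set \<Rightarrow> ('a \<times> 'a) set" where
  "pairs A = {(x, y). x \<in> A \<and> y \<in> A \<and> x \<noteq> y}"

definition llull_matrix :: "'a set \<Rightarrow> ('a \<Rightarrow> 'a \<Rightarrow> real) \<Rightarrow> bool" where
  "llull_matrix A v \<longleftrightarrow>
     (\<forall>(x, y) \<in> pairs A. 0 \<le> v x y \<and> v x y \<le> 1 \<and> v x y + v y x \<le> 1)"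

definition turnout :: "('a \<Rightarrow> 'a \<Rightarrow> real) \<Rightarrow> 'a \<Rightarrow> 'a \<Rightarrow> real" where
  "turnout v x y = v x y + v y x"


subsection \<open>Individual votes\<close>

definition aggregates ::
  "'a set \<Rightarrow> 'k set \<Rightarrow> ('k \<Rightarrow> real) \<Rightarrow> ('k \<Rightarrow> 'a \<Rightarrow> 'a \<Rightarrow> real) \<Rightarrow> ('a \<Rightarrow> 'a \<Rightarrow> real) \<Rightarrow> bool" where
  "aggregates A K \<alpha> w v \<longleftrightarrow>
     finite K \<and> (\<forall>k\<in>K. \<alpha> k > 0) \<and> (\<Sum>k\<in>K. \<alpha> k) = 1 \<and> (\<forall>k\<in>K. llull_matrix A (w k)) \<and>
     (\<forall>(x, y) \<in> pairs A. v x y = (\<Sum>k\<in>K. \<alpha> k * w k x y))"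

definition rel_vote :: "('a \<times> 'a) set \<Rightarrow> 'a \<Rightarrow> 'a \<Rightarrow> real" where
  "rel_vote \<rho> x y =
     (if (x, y) \<in> \<rho> \<and> (y, x) \<notin> \<rho> then 1
      else if (x, y) \<in> \<rho> \<and> (y, x) \<in> \<rho> then 1 / 2
      else 0)"

text \<open>
  The constant \<^const>\<open>trans\<close> is not appropriate here: preference relations contain no pairs
  \<open>(x, x)\<close>, but ties, i.e. both \<open>(x, y)\<close> and \<open>(y, x)\<close>, are allowed.
\<close>

definition transitive_relation :: "('a \<times> 'a) set \<Rightarrow> bool" where
  "transitive_relation \<rho> \<longleftrightarrow>
     (\<forall>x y z. (x, y) \<in> \<rho> \<longrightarrow> (y, z) \<in> \<rho> \<longrightarrow> x \<noteq> z \<longrightarrow> (x, z) \<in> \<rho>)"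

definition transitive_votes ::
  "'a set \<Rightarrow> 'k set \<Rightarrow> ('k \<Rightarrow> 'a \<Rightarrow> 'a \<Rightarrow> real) \<Rightarrow> bool" where
  "transitive_votes A K w \<longleftrightarrow>
     (\<forall>k\<in>K. \<exists>\<rho>. \<rho> \<subseteq> pairs A \<and> transitive_relation \<rho> \<and>
        (\<forall>(x, y) \<in> pairs A. w k x y = rel_vote \<rho> x y))"


subsection \<open>Indirect scores and admissible orders\<close>

definition is_path :: "'a set \<Rightarrow> 'a \<Rightarrow> 'a \<Rightarrow> 'a list \<Rightarrow> bool" where
  "is_path A x y p \<longleftrightarrow>
     length p \<ge> 2 \<and> set p \<subseteq> A \<and> distinct_adj p \<and> hd p = x \<and> last p = y"

definition path_score :: "('a \<Rightarrow> 'a \<Rightarrow> real) \<Rightarrow> 'a list \<Rightarrow> real" where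
  "path_score v p = Min ((\<lambda>i. v (p ! i) (p ! Suc i)) ` {..<length p - 1})"

text \<open>
  There are infinitely many paths, but their scores are entries of \<open>v\<close>, hence finitely many, so
  that \<^const>\<open>Max\<close> is meaningful.
\<close>

definition indirect_score :: "'a set \<Rightarrow> ('a \<Rightarrow> 'a \<Rightarrow> real) \<Rightarrow> 'a \<Rightarrow> 'a \<Rightarrow> real" where
  "indirect_score A v x y = Max (path_score v ` {p. is_path A x y p})"

definition indirect_margin :: "'a set \<Rightarrow> ('a \<Rightarrow> 'a \<Rightarrow> real) \<Rightarrow> 'a \<Rightarrow> 'a \<Rightarrow> real" where
  "indirect_margin A v x y = indirect_score A v x y - indirect_score A v y x"

definition indirect_comparison :: "'a set \<Rightarrow> ('a \<Rightarrow> 'a \<Rightarrow> real) \<Rightarrow> ('a \<times> 'a) set" where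
  "indirect_comparison A v = {(x, y) \<in> pairs A. indirect_margin A v x y > 0}"

definition admissible_order :: "'a set \<Rightarrow> ('a \<Rightarrow> 'a \<Rightarrow> real) \<Rightarrow> ('a \<times> 'a) set \<Rightarrow> bool" where
  "admissible_order A v \<xi> \<longleftrightarrow>
     \<xi> \<subseteq> pairs A \<and> strict_linear_order_on A \<xi> \<and> indirect_comparison A v \<subseteq> \<xi>"


subsection \<open>Projection\<close>

text \<open>
  In the following, \<open>\<xi>\<close> is an admissible order; \<open>(x, y) \<in> \<xi>\<close> means that \<open>x\<close> precedes \<open>y\<close>, so
  \<open>Domain \<xi>\<close> consists of the options that are not last, and \<open>next_opt \<xi> x\<close> is meaningful
  only for these.
\<close>

definition next_opt :: "('a \<times> 'a) set \<Rightarrow> 'a \<Rightarrow> 'a" where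
  "next_opt \<xi> x = (THE y. (x, y) \<in> \<xi> \<and> (\<forall>z. (x, z) \<in> \<xi> \<longrightarrow> (y, z) \<in> \<xi>\<^sup>=))"

text \<open>\<open>sigma_margin A v \<xi> x\<close> is $m^\sigma_{xx'}$.\<close>

definition sigma_margin ::
  "'a set \<Rightarrow> ('a \<Rightarrow> 'a \<Rightarrow> real) \<Rightarrow> ('a \<times> 'a) set \<Rightarrow> 'a \<Rightarrow> real" where
  "sigma_margin A v \<xi> x =
     Min {indirect_margin A v p q | p q. (p, x) \<in> \<xi>\<^sup>= \<and> (next_opt \<xi> x, q) \<in> \<xi>\<^sup>=}"

text \<open>
  The first clause represents elements of $\mathbb{R}^\Pi$ by functions vanishing outside
  \<open>pairs A\<close>, which makes the minimizer below unique as a function.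
\<close>

definition feasible_turnouts ::
  "'a set \<Rightarrow> ('a \<Rightarrow> 'a \<Rightarrow> real) \<Rightarrow> ('a \<times> 'a) set \<Rightarrow> ('a \<Rightarrow> 'a \<Rightarrow> real) \<Rightarrow> bool" where
  "feasible_turnouts A v \<xi> \<tau> \<longleftrightarrow>
     (\<forall>x y. (x, y) \<notin> pairs A \<longrightarrow> \<tau> x y = 0) \<and>
     (\<forall>(x, y) \<in> pairs A. \<tau> x y = \<tau> y x) \<and>
     (\<forall>x \<in> Domain \<xi>. sigma_margin A v \<xi> x \<le> \<tau> x (next_opt \<xi> x) \<and> \<tau> x (next_opt \<xi> x) \<le> 1) \<and>
     (\<forall>x \<in> Domain \<xi>. \<forall>z \<in> A - {x, next_opt \<xi> x}.
        0 \<le> \<tau> x z - \<tau> (next_opt \<xi> x) z \<and>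
        \<tau> x z - \<tau> (next_opt \<xi> x) z \<le> sigma_margin A v \<xi> x)"

definition sigma_turnout ::
  "'a set \<Rightarrow> ('a \<Rightarrow> 'a \<Rightarrow> real) \<Rightarrow> ('a \<times> 'a) set \<Rightarrow> 'a \<Rightarrow> 'a \<Rightarrow> real" where
  "sigma_turnout A v \<xi> =
     (THE \<tau>. is_arg_min (\<lambda>\<tau>. \<Sum>x\<in>A. \<Sum>y\<in>A - {x}. (\<tau> x y - turnout v x y)\<^sup>2)
               (feasible_turnouts A v \<xi>) \<tau>)"

text \<open>
  \<open>upper_score A v \<xi> x\<close> and \<open>lower_score A v \<xi> x\<close> are $v^\pi_{xx'}$ and $v^\pi_{x'x}$.
\<close>

definition upper_score ::
  "'a set \<Rightarrow> ('a \<Rightarrow> 'a \<Rightarrow> real) \<Rightarrow> ('a \<times> 'a) set \<Rightarrow> 'a \<Rightarrow> real" where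
  "upper_score A v \<xi> x = (sigma_turnout A v \<xi> x (next_opt \<xi> x) + sigma_margin A v \<xi> x) / 2"

definition lower_score ::
  "'a set \<Rightarrow> ('a \<Rightarrow> 'a \<Rightarrow> real) \<Rightarrow> ('a \<times> 'a) set \<Rightarrow> 'a \<Rightarrow> real" where
  "lower_score A v \<xi> x = (sigma_turnout A v \<xi> x (next_opt \<xi> x) - sigma_margin A v \<xi> x) / 2"

definition projected_score ::
  "'a set \<Rightarrow> ('a \<Rightarrow> 'a \<Rightarrow> real) \<Rightarrow> ('a \<times> 'a) set \<Rightarrow> 'a \<Rightarrow> 'a \<Rightarrow> real" where
  "projected_score A v \<xi> x y =
     (if (x, y) \<in> \<xi>
      then Max (upper_score A v \<xi> ` {p. (x, p) \<in> \<xi>\<^sup>= \<and> (p, y) \<in> \<xi>})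
      else Min (lower_score A v \<xi> ` {p. (y, p) \<in> \<xi>\<^sup>= \<and> (p, x) \<in> \<xi>}))"

definition rank_like_rate ::
  "'a set \<Rightarrow> ('a \<Rightarrow> 'a \<Rightarrow> real) \<Rightarrow> ('a \<times> 'a) set \<Rightarrow> 'a \<Rightarrow> real" where
  "rank_like_rate A v \<xi> x = real (card A) - (\<Sum>y\<in>A - {x}. projected_score A v \<xi> x y)"

end

theory Submission
  imports Defs "HOL-Analysis.Function_Topology"
begin

text \<open>
  Every projected score is at most \<open>1\<close>, and so is every projected turnout
  \<open>v\<^sup>\<pi>\<^sub>x\<^sub>y + v\<^sup>\<pi>\<^sub>y\<^sub>x\<close>; hence \<open>|X| (|X| + 1) / 2\<close> is the least possible value of the
  sum of the rates over \<open>X\<close>, attained only if all projected scores from \<open>X\<close> to \<open>Y\<close> are \<open>1\<close>.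
  The latter means that \<open>X\<close> is an initial segment of \<open>\<xi>\<close> whose border margin
  \<open>m\<^sup>\<sigma>\<close> is \<open>1\<close>, i.e. that all indirect margins from \<open>X\<close> to \<open>Y\<close> are \<open>1\<close>.
  Conversely, a border margin \<open>1\<close> forces the border turnout to be \<open>1\<close>, and by monotonicity of
  \<open>t\<^sup>\<sigma>\<close> all the turnouts between consecutive elements of \<open>X\<close> as well, so that the minimum is
  attained. Finally, an indirect score \<open>1\<close> is carried by a path whose every step is a
  unanimous strict preference, which transitivity contracts to a single step.
\<close>

section \<open>Compactness and continuity in function spaces\<close>

text \<open>Tychonoff's theorem for full function spaces. Applied twice, once per argument, it gives
  compact cubes of curried matrices.\<close>

lemma compact_fun_coordinatewise:
  fixes S :: "'i \<Rightarrow> 'b::topological_space set"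
  assumes "\<And>i. compact (S i)"
  shows "compact {f. \<forall>i. f i \<in> S i}"
proof -
  have "compactin (product_topology (\<lambda>i. euclidean) UNIV) (PiE UNIV S)"
    using assms by (simp add: compactin_PiE)
  then have "compact (PiE UNIV S)"
    by (simp add: euclidean_product_topology)
  then show ?thesis
    by (simp add: PiE_UNIV_domain Pi_def)
qed

lemma continuous_on_entry [continuous_intros]:
  "continuous_on UNIV (\<lambda>f :: 'i \<Rightarrow> 'j \<Rightarrow> 'b::topological_space. f i j)"
  using continuous_on_product_then_coordinatewise[OF continuous_on_product_coordinates] .

section \<open>Paths and their scores\<close>

lemma le_path_score_iff:
  assumes "is_path A x y p"
  shows "c \<le> path_score v p \<longleftrightarrow> (\<forall>i < length p - 1. c \<le> v (p ! i) (p ! Suc i))"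
proof -
  have "{..<length p - 1} \<noteq> {}"
    using assms by (auto simp: is_path_def lessThan_empty_iff)
  then show ?thesis
    by (auto simp: path_score_def)
qed

lemma is_path_ends:
  assumes "is_path A x y p"
  shows "p ! 0 = x" "p ! (length p - 1) = y" "length p \<ge> 2"
proof -
  have "p \<noteq> []"
    using assms by (auto simp: is_path_def)
  then show "p ! 0 = x" "p ! (length p - 1) = y" "length p \<ge> 2"
    using assms hd_conv_nth[of p] last_conv_nth[of p] by (auto simp: is_path_def)
qed

lemma is_path_pair:
  "x \<in> A \<Longrightarrow> y \<in> A \<Longrightarrow> x \<noteq> y \<Longrightarrow> is_path A x y [x, y]"
  by (simp add: is_path_def)

lemma path_score_pair: "path_score v [x, y] = v x y"
  by (simp add: path_score_def lessThan_Suc)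

lemma is_path_step:
  assumes "is_path A x y p" "i < length p - 1"
  shows "(p ! i, p ! Suc i) \<in> pairs A"
  using assms by (auto simp: is_path_def pairs_def distinct_adj_conv_nth subset_iff)

text \<open>For finite \<open>A\<close> there are finitely many entries, so the \<open>Max\<close>
  over the infinitely many paths is attained, and bounds on entries carry over to indirect
  scores.\<close>

lemma path_score_in_entries:
  assumes "is_path A x y p"
  shows "path_score v p \<in> (\<lambda>(a, b). v a b) ` pairs A"
proof -
  have "{..<length p - 1} \<noteq> {}"
    using assms by (auto simp: is_path_def lessThan_empty_iff)
  then have "path_score v p \<in> (\<lambda>i. v (p ! i) (p ! Suc i)) ` {..<length p - 1}"
    unfolding path_score_def by (intro Min_in) auto
  then show ?thesis
    using is_path_step[OF assms] by force
qed

text \<open>The first index at which the path lies in \<open>X\<close> is positive, since the path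
  starts outside; its predecessor is the crossing.\<close>

lemma is_path_crossing:
  assumes "is_path A y x p" "y \<notin> X" "x \<in> X"
  obtains i where "i < length p - 1" "p ! i \<in> A - X" "p ! Suc i \<in> X"
proof -
  have ends: "p ! 0 \<notin> X" "p ! (length p - 1) \<in> X" and len: "length p \<ge> 2"
    and "set p \<subseteq> A"
    using is_path_ends[OF assms(1)] assms by (simp_all add: is_path_def)
  obtain n where "p ! n \<in> X" "n \<le> length p - 1" "\<forall>j < n. p ! j \<notin> X"
    using ex_least_nat_le[of "\<lambda>n. p ! n \<in> X" "length p - 1"] ends by auto
  with ends obtain i where "n = Suc i" "p ! i \<notin> X"
    by (cases n) auto
  with \<open>p ! n \<in> X\<close> \<open>n \<le> _\<close> \<open>set p \<subseteq> A\<close> len show thesis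
    by (intro that[of i]) auto
qed

locale admissible_llull =
  fixes A :: "'a set" and v :: "'a \<Rightarrow> 'a \<Rightarrow> real" and \<xi> :: "('a \<times> 'a) set"
  assumes finite_A: "finite A"
    and llull: "llull_matrix A v"
    and admissible: "admissible_order A v \<xi>"
begin

lemma finite_pairs: "finite (pairs A)"
  by (rule finite_subset[of _ "A \<times> A"]) (auto simp: pairs_def finite_A)

lemma entry_bounds:
  assumes "x \<in> A" "y \<in> A" "x \<noteq> y"
  shows "0 \<le> v x y" "v x y \<le> 1" "v x y + v y x \<le> 1"
  using llull assms by (auto simp: llull_matrix_def pairs_def)


subsection \<open>Indirect scores\<close>

lemma finite_path_scores: "finite (path_score v ` {p. is_path A x y p})"
  by (rule finite_subset[of _ "(\<lambda>(a, b). v a b) ` pairs A"])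
    (auto intro: path_score_in_entries finite_pairs)

lemma path_score_le_indirect:
  "is_path A x y p \<Longrightarrow> path_score v p \<le> indirect_score A v x y"
  unfolding indirect_score_def by (intro Max_ge finite_path_scores) auto

lemma entry_le_indirect:
  "x \<in> A \<Longrightarrow> y \<in> A \<Longrightarrow> x \<noteq> y \<Longrightarrow> v x y \<le> indirect_score A v x y"
  using path_score_le_indirect[OF is_path_pair] by (simp add: path_score_pair)

lemma indirect_score_attained:
  assumes "x \<in> A" "y \<in> A" "x \<noteq> y"
  obtains p where "is_path A x y p" "path_score v p = indirect_score A v x y"
proof -
  have "indirect_score A v x y \<in> path_score v ` {p. is_path A x y p}"
    unfolding indirect_score_def
    using is_path_pair[OF assms] by (intro Max_in finite_path_scores) auto
  then show thesis
    using that by auto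
qed

lemma indirect_score_bounds:
  assumes "x \<in> A" "y \<in> A" "x \<noteq> y"
  shows "0 \<le> indirect_score A v x y" "indirect_score A v x y \<le> 1"
proof -
  show "0 \<le> indirect_score A v x y"
    using entry_le_indirect entry_bounds assms by (meson order_trans)
  obtain p where "is_path A x y p" "path_score v p = indirect_score A v x y"
    using indirect_score_attained[OF assms] .
  then have "indirect_score A v x y \<in> (\<lambda>(a, b). v a b) ` pairs A"
    using path_score_in_entries by metis
  then show "indirect_score A v x y \<le> 1"
    by (auto simp: pairs_def entry_bounds)
qed

text \<open>Every path from \<open>A - X\<close> into \<open>X\<close> has to cross the border at
  some step, and the entry used there is \<open>0\<close>.\<close>

lemma indirect_score_eq_0:
  assumes "X \<subseteq> A" "\<And>x y. x \<in> X \<Longrightarrow> y \<in> A - X \<Longrightarrow> v y x = 0"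
    and "x \<in> X" "y \<in> A - X"
  shows "indirect_score A v y x = 0"
proof -
  have "x \<in> A" "y \<in> A" "x \<noteq> y"
    using assms by auto
  then obtain p where p: "is_path A y x p" "path_score v p = indirect_score A v y x"
    using indirect_score_attained by metis
  obtain i where "i < length p - 1" "p ! i \<in> A - X" "p ! Suc i \<in> X"
    using is_path_crossing[OF p(1)] assms by blast
  then have "path_score v p \<le> 0"
    using le_path_score_iff[OF p(1), of "path_score v p" v] assms(2) by fastforce
  then show ?thesis
    using p(2) indirect_score_bounds \<open>x \<in> A\<close> \<open>y \<in> A\<close> \<open>x \<noteq> y\<close> by fastforce
qed

lemma indirect_margin_le_1:
  assumes "x \<in> A" "y \<in> A" "x \<noteq> y"
  shows "indirect_margin A v x y \<le> 1"
  using indirect_score_bounds[of x y] indirect_score_bounds[of y x] assms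
  by (simp add: indirect_margin_def)


subsection \<open>The admissible order\<close>

lemma ordD: "(x, y) \<in> \<xi> \<Longrightarrow> x \<in> A \<and> y \<in> A \<and> x \<noteq> y"
  using admissible by (auto simp: admissible_order_def pairs_def)

lemma ord_trans: "(x, y) \<in> \<xi> \<Longrightarrow> (y, z) \<in> \<xi> \<Longrightarrow> (x, z) \<in> \<xi>"
  using admissible
  by (auto simp: admissible_order_def strict_linear_order_on_def intro: transD)

lemma ord_asym: "(x, y) \<in> \<xi> \<Longrightarrow> (y, x) \<notin> \<xi>"
  using ord_trans ordD by blast

lemma ord_total: "x \<in> A \<Longrightarrow> y \<in> A \<Longrightarrow> x \<noteq> y \<Longrightarrow> (x, y) \<in> \<xi> \<or> (y, x) \<in> \<xi>"
  using admissible
  by (auto simp: admissible_order_def strict_linear_order_on_def total_on_def)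

lemma finite_ord: "finite \<xi>"
  using finite_subset[OF _ finite_pairs] admissible by (auto simp: admissible_order_def)

lemma acyclic_ord: "acyclic \<xi>"
  unfolding acyclic_irrefl by (subst trancl_id) (use ord_trans ordD in \<open>blast intro: transI irreflI\<close>)+

lemma wf_ord: "wf \<xi>" and wf_ord_converse: "wf (\<xi>\<inverse>)"
  using finite_acyclic_wf finite_acyclic_wf_converse finite_ord acyclic_ord by auto

abbreviation nxt :: "'a \<Rightarrow> 'a" where "nxt \<equiv> next_opt \<xi>"

text \<open>Above a non-last \<open>x\<close> there is a minimal element by well-foundedness, and
  totality makes it least. Hence the definite description in \<open>next_opt\<close>
  denotes.\<close>

lemma nxt:
  assumes "(x, z) \<in> \<xi>"
  shows nxt_greater: "(x, nxt x) \<in> \<xi>" and nxt_least: "(nxt x, z) \<in> \<xi>\<^sup>="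
proof -
  obtain y where y: "(x, y) \<in> \<xi>" "\<And>u. (u, y) \<in> \<xi> \<Longrightarrow> (x, u) \<notin> \<xi>"
    using wfE_min[OF wf_ord, of z "{u. (x, u) \<in> \<xi>}"] assms by auto
  have "(y, u) \<in> \<xi>\<^sup>=" if "(x, u) \<in> \<xi>" for u
    using that y ord_total[of y u] ordD by blast
  then have "\<exists>!y. (x, y) \<in> \<xi> \<and> (\<forall>z. (x, z) \<in> \<xi> \<longrightarrow> (y, z) \<in> \<xi>\<^sup>=)"
    using y(1) ord_asym by (intro ex1I[of _ y]) auto
  from theI'[OF this] show "(x, nxt x) \<in> \<xi>" "(nxt x, z) \<in> \<xi>\<^sup>="
    using assms unfolding next_opt_def by blast+
qed

lemma Domain_nxt: "x \<in> Domain \<xi> \<Longrightarrow> (x, nxt x) \<in> \<xi>"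
  using nxt_greater by blast

text \<open>Walking from \<open>x\<close> through immediate successors never skips \<open>y\<close>,
  by \<open>nxt_least\<close>. This extends conditions on consecutive options to arbitrary
  pairs.\<close>

lemma ord_induct [consumes 1, case_names nxt step]:
  assumes "(x, y) \<in> \<xi>"
    and "\<And>x. (x, y) \<in> \<xi> \<Longrightarrow> nxt x = y \<Longrightarrow> P x"
    and "\<And>x. (x, y) \<in> \<xi> \<Longrightarrow> (x, nxt x) \<in> \<xi> \<Longrightarrow> (nxt x, y) \<in> \<xi> \<Longrightarrow> P (nxt x) \<Longrightarrow> P x"
  shows "P x"
  using assms(1)
proof (induction x rule: wf_induct_rule[OF wf_ord_converse])
  case (1 x)
  then show ?case
    using nxt[OF 1(2)] assms(2,3) by (cases "nxt x = y") auto
qed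

lemma pred_exists:
  assumes "(x, y) \<in> \<xi>"
  obtains p where "(x, p) \<in> \<xi>\<^sup>=" "(p, y) \<in> \<xi>" "nxt p = y"
proof -
  have "\<exists>p. (x, p) \<in> \<xi>\<^sup>= \<and> (p, y) \<in> \<xi> \<and> nxt p = y"
    using assms
  proof (induction rule: ord_induct)
    case (step x)
    then show ?case using ord_trans by blast
  qed auto
  then show thesis using that by blast
qed


subsection \<open>Projected margins\<close>

abbreviation m\<sigma> :: "'a \<Rightarrow> real" where "m\<sigma> \<equiv> sigma_margin A v \<xi>"

text \<open>A negative margin would put the reversed pair into the comparison relation, hence into
  \<open>\<xi>\<close>.\<close>

lemma indirect_margin_nonneg:
  assumes "(x, y) \<in> \<xi>"
  shows "0 \<le> indirect_margin A v x y"
proof -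
  have "(y, x) \<notin> indirect_comparison A v"
    using assms ord_asym admissible by (auto simp: admissible_order_def)
  then show ?thesis
    using ordD[OF assms] by (auto simp: indirect_comparison_def pairs_def indirect_margin_def)
qed

lemma le_sigma_margin_iff:
  assumes "x \<in> Domain \<xi>"
  shows "c \<le> m\<sigma> x \<longleftrightarrow>
    (\<forall>p q. (p, x) \<in> \<xi>\<^sup>= \<longrightarrow> (nxt x, q) \<in> \<xi>\<^sup>= \<longrightarrow> c \<le> indirect_margin A v p q)"
proof -
  let ?M = "{indirect_margin A v p q | p q. (p, x) \<in> \<xi>\<^sup>= \<and> (nxt x, q) \<in> \<xi>\<^sup>=}"
  have "?M \<subseteq> (\<lambda>(p, q). indirect_margin A v p q) ` (A \<times> A)"
    using Domain_nxt[OF assms] ordD by fastforce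
  then have "finite ?M"
    using finite_A by (meson finite_SigmaI finite_imageI finite_subset)
  moreover have "?M \<noteq> {}" by auto
  ultimately have "c \<le> m\<sigma> x \<longleftrightarrow> (\<forall>a \<in> ?M. c \<le> a)"
    unfolding sigma_margin_def by (rule Min_ge_iff)
  then show ?thesis
    by blast
qed

lemma sigma_margin_bounds:
  assumes "x \<in> Domain \<xi>"
  shows "0 \<le> m\<sigma> x" "m\<sigma> x \<le> 1"
proof -
  have "(p, q) \<in> \<xi>" if "(p, x) \<in> \<xi>\<^sup>=" "(nxt x, q) \<in> \<xi>\<^sup>=" for p q
    using that Domain_nxt[OF assms] ord_trans by blast
  then show "0 \<le> m\<sigma> x"
    using indirect_margin_nonneg assms by (auto simp: le_sigma_margin_iff)
  have "m\<sigma> x \<le> indirect_margin A v x (nxt x)"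
    using le_sigma_margin_iff[OF assms, of "m\<sigma> x"] by auto
  also have "\<dots> \<le> 1"
    using ordD[OF Domain_nxt[OF assms]] by (intro indirect_margin_le_1) auto
  finally show "m\<sigma> x \<le> 1" .
qed


subsection \<open>Projected turnouts\<close>

abbreviation feasible :: "('a \<Rightarrow> 'a \<Rightarrow> real) \<Rightarrow> bool" where
  "feasible \<equiv> feasible_turnouts A v \<xi>"

lemma feasible_outside: "feasible \<tau> \<Longrightarrow> (x, y) \<notin> pairs A \<Longrightarrow> \<tau> x y = 0"
  by (simp add: feasible_turnouts_def)

lemma feasible_sym: "feasible \<tau> \<Longrightarrow> \<tau> x y = \<tau> y x"
  by (cases "(x, y) \<in> pairs A") (auto simp: feasible_turnouts_def pairs_def)

lemma feasible_nxt:
  assumes "feasible \<tau>" "x \<in> Domain \<xi>"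
  shows "m\<sigma> x \<le> \<tau> x (nxt x)" "\<tau> x (nxt x) \<le> 1"
  using assms by (auto simp: feasible_turnouts_def)

lemma feasible_step:
  assumes "feasible \<tau>" "x \<in> Domain \<xi>" "z \<in> A" "z \<noteq> x" "z \<noteq> nxt x"
  shows "\<tau> (nxt x) z \<le> \<tau> x z" "\<tau> x z \<le> \<tau> (nxt x) z + m\<sigma> x"
  using assms by (force simp: feasible_turnouts_def algebra_simps)+

text \<open>The row constraints are chained along successors. As \<open>z\<close> lies before
  \<open>x\<close> or after \<open>y\<close>, no step of the chain meets the excluded columns
  \<open>x\<close> and \<open>nxt x\<close>.\<close>

lemma feasible_mono:
  assumes "feasible \<tau>" "(x, y) \<in> \<xi>" "(z, x) \<in> \<xi> \<or> (y, z) \<in> \<xi>"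
  shows "\<tau> y z \<le> \<tau> x z"
  using assms(2,3)
proof (induction rule: ord_induct)
  case (nxt x)
  then have "z \<in> A" "z \<noteq> x" "z \<noteq> nxt x"
    using ordD ord_trans ord_asym by blast+
  then show ?case
    using feasible_step(1)[OF assms(1), of x z] nxt by auto
next
  case (step x)
  have "(z, nxt x) \<in> \<xi> \<or> (y, z) \<in> \<xi>"
    using step ord_trans by blast
  moreover have "\<tau> (nxt x) z \<le> \<tau> x z"
    using step by (intro feasible_step(1) assms) (use ordD ord_trans ord_asym in blast)+
  ultimately show ?case
    using step.IH by linarith
qed

text \<open>\<open>x\<close> precedes both \<open>nxt x\<close> and \<open>z\<close>, so by symmetry
  \<open>feasible_mono\<close> applies with \<open>x\<close> as the third option.\<close>

lemma feasible_le_nxt: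
  assumes "feasible \<tau>" "(x, z) \<in> \<xi>"
  shows "\<tau> x z \<le> \<tau> x (nxt x)"
proof (cases "nxt x = z")
  case False
  then have "(nxt x, z) \<in> \<xi>" "(x, nxt x) \<in> \<xi>"
    using nxt[OF assms(2)] by auto
  then show ?thesis
    using feasible_mono[OF assms(1), of "nxt x" z x] feasible_sym[OF assms(1)] by metis
qed auto

text \<open>Consecutive pairs give both bounds: from above \<open>\<tau> x (nxt x)\<close>, from
  below \<open>\<tau> p z\<close> with \<open>p\<close> the predecessor of \<open>z\<close>, which
  is at least \<open>m\<sigma> p\<close>.\<close>

lemma feasible_bounds:
  assumes "feasible \<tau>" "(x, z) \<in> \<xi>"
  shows "0 \<le> \<tau> x z" "\<tau> x z \<le> 1"
proof -
  show "\<tau> x z \<le> 1"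
    using feasible_le_nxt[OF assms] feasible_nxt[OF assms(1), of x] assms(2) by force
  obtain p where p: "(x, p) \<in> \<xi>\<^sup>=" "(p, z) \<in> \<xi>" "nxt p = z"
    using pred_exists[OF assms(2)] .
  then have "0 \<le> \<tau> p z"
    using feasible_nxt[OF assms(1), of p] sigma_margin_bounds[of p] by force
  moreover have "\<tau> p z \<le> \<tau> x z"
    using p feasible_mono[OF assms(1), of x p z] by auto
  ultimately show "0 \<le> \<tau> x z" by linarith
qed

lemma feasible_range:
  assumes "feasible \<tau>"
  shows "\<tau> x y \<in> {0..1}"
proof (cases "(x, y) \<in> pairs A")
  case True
  then have "(x, y) \<in> \<xi> \<or> (y, x) \<in> \<xi>"
    using ord_total by (auto simp: pairs_def)
  then show ?thesis
    using feasible_bounds[OF assms, of x y] feasible_bounds[OF assms, of y x]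
      feasible_sym[OF assms, of x y] by auto
qed (simp add: feasible_outside[OF assms])

section \<open>Existence and uniqueness of the least-squares turnouts\<close>

text \<open>A closed subset of the compact cube of matrices with entries in
  \<open>{0..1}\<close>.\<close>

lemma compact_feasible: "compact {\<tau>. feasible \<tau>}"
proof -
  \<comment> \<open>Once implications are written as disjunctions, their premises are constant
    conditions, and what remains are equations and weak inequalities between continuous functions of
    the entries.\<close>
  have "closed {\<tau>. feasible \<tau>}"
    unfolding feasible_turnouts_def case_prod_beta Ball_def imp_conv_disj
    by (intro closed_Collect_conj closed_Collect_all closed_Collect_disj
        closed_Collect_le closed_Collect_eq closed_Collect_const continuous_intros)
  moreover have "compact {\<tau> :: 'a \<Rightarrow> 'a \<Rightarrow> real. \<forall>x. \<tau> x \<in> {f. \<forall>y. f y \<in> {0..1}}}"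
    by (intro compact_fun_coordinatewise compact_Icc)
  ultimately have "compact ({\<tau> :: 'a \<Rightarrow> 'a \<Rightarrow> real. \<forall>x. \<tau> x \<in> {f. \<forall>y. f y \<in> {0..1}}} \<inter> {\<tau>. feasible \<tau>})"
    by (rule compact_Int_closed[rotated])
  also have "\<dots> = {\<tau>. feasible \<tau>}"
    using feasible_range by auto
  finally show ?thesis .
qed

text \<open>Complete turnouts witness non-emptiness: projected margins lie between \<open>0\<close>
  and \<open>1\<close>, and all differences of rows vanish.\<close>

lemma feasible_one: "feasible (\<lambda>x y. if (x, y) \<in> pairs A then 1 else 0)"
proof -
  have "(x, nxt x) \<in> pairs A" if "x \<in> Domain \<xi>" for x
    using ordD[OF Domain_nxt[OF that]] by (simp add: pairs_def)
  then show ?thesis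
    using sigma_margin_bounds by (auto simp: feasible_turnouts_def pairs_def)
qed

text \<open>All constraints are affine, and the midpoint is the convex combination that the
  uniqueness proof compares with.\<close>

lemma feasible_midpoint:
  assumes "feasible \<tau>" "feasible \<tau>'"
  shows "feasible (\<lambda>x y. (\<tau> x y + \<tau>' x y) / 2)"
  unfolding feasible_turnouts_def
proof (intro conjI ballI allI impI)
  fix x z assume *: "x \<in> Domain \<xi>" "z \<in> A - {x, nxt x}"
  show "0 \<le> (\<tau> x z + \<tau>' x z) / 2 - (\<tau> (nxt x) z + \<tau>' (nxt x) z) / 2"
    "(\<tau> x z + \<tau>' x z) / 2 - (\<tau> (nxt x) z + \<tau>' (nxt x) z) / 2 \<le> m\<sigma> x"
    using feasible_step[OF assms(1) *(1), of z] feasible_step[OF assms(2) *(1), of z] *(2)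
    by (auto simp: field_simps)
next
  fix x assume "x \<in> Domain \<xi>"
  from feasible_nxt[OF assms(1) this] feasible_nxt[OF assms(2) this]
  show "m\<sigma> x \<le> (\<tau> x (nxt x) + \<tau>' x (nxt x)) / 2"
    "(\<tau> x (nxt x) + \<tau>' x (nxt x)) / 2 \<le> 1"
    by auto
next
  fix p
  show "case p of (x, y) \<Rightarrow> (\<tau> x y + \<tau>' x y) / 2 = (\<tau> y x + \<tau>' y x) / 2"
    using feasible_sym[OF assms(1)] feasible_sym[OF assms(2)] by (simp add: case_prod_beta)
qed (simp add: feasible_outside[OF assms(1)] feasible_outside[OF assms(2)])

definition turnout_dist :: "('a \<Rightarrow> 'a \<Rightarrow> real) \<Rightarrow> real" where
  "turnout_dist \<tau> = (\<Sum>x\<in>A. \<Sum>y\<in>A - {x}. (\<tau> x y - turnout v x y)\<^sup>2)"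

text \<open>The parallelogram identity, summed over all pairs: a quantitative form of strict
  convexity.\<close>

lemma turnout_dist_midpoint:
  "turnout_dist (\<lambda>x y. (\<tau> x y + \<tau>' x y) / 2) =
     (turnout_dist \<tau> + turnout_dist \<tau>') / 2
       - (\<Sum>x\<in>A. \<Sum>y\<in>A - {x}. (\<tau> x y - \<tau>' x y)\<^sup>2) / 4"
proof -
  have "((\<tau> x y + \<tau>' x y) / 2 - t)\<^sup>2 =
      ((\<tau> x y - t)\<^sup>2 + (\<tau>' x y - t)\<^sup>2) / 2 - (\<tau> x y - \<tau>' x y)\<^sup>2 / 4" for x y t
    by (simp add: power2_eq_square field_simps)
  then show ?thesis
    by (simp add: turnout_dist_def sum.distrib sum_subtractf flip: sum_divide_distrib)
qed

text \<open>The midpoint of two minimizers cannot improve on their common value, so their squared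
  distance is \<open>0\<close>. Outside \<open>pairs A\<close> both vanish by convention.\<close>

lemma minimizer_unique:
  assumes "is_arg_min turnout_dist feasible \<tau>" "is_arg_min turnout_dist feasible \<tau>'"
  shows "\<tau> = \<tau>'"
proof -
  let ?d = "\<Sum>x\<in>A. \<Sum>y\<in>A - {x}. (\<tau> x y - \<tau>' x y)\<^sup>2"
  have feas: "feasible \<tau>" "feasible \<tau>'"
    and le: "\<And>\<upsilon>. feasible \<upsilon> \<Longrightarrow> turnout_dist \<tau> \<le> turnout_dist \<upsilon>"
      "\<And>\<upsilon>. feasible \<upsilon> \<Longrightarrow> turnout_dist \<tau>' \<le> turnout_dist \<upsilon>"
    using assms by (simp_all add: is_arg_min_linorder)
  have "turnout_dist \<tau> = turnout_dist \<tau>'"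
    using le feas by (intro antisym) auto
  moreover have "turnout_dist \<tau> \<le> turnout_dist (\<lambda>x y. (\<tau> x y + \<tau>' x y) / 2)"
    by (rule le(1)[OF feasible_midpoint[OF feas]])
  ultimately have "?d \<le> 0"
    unfolding turnout_dist_midpoint by simp
  moreover have "?d \<ge> 0"
    by (intro sum_nonneg) auto
  ultimately have "?d = 0" by linarith
  then have "\<forall>x\<in>A. \<forall>y\<in>A - {x}. \<tau> x y = \<tau>' x y"
    using finite_A by (simp add: sum_nonneg_eq_0_iff sum_nonneg)
  then have "\<tau> x y = \<tau>' x y" if "(x, y) \<in> pairs A" for x y
    using that by (auto simp: pairs_def)
  then show ?thesis
    using feasible_outside[OF feas(1)] feasible_outside[OF feas(2)] by (metis ext)
qed

abbreviation t\<sigma> :: "'a \<Rightarrow> 'a \<Rightarrow> real" where "t\<sigma> \<equiv> sigma_turnout A v \<xi>"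

text \<open>Compactness gives a minimizer and strict convexity its uniqueness, so that
  \<open>THE\<close> denotes and inherits feasibility.\<close>

lemma feasible_sigma_turnout: "feasible t\<sigma>"
proof -
  have "continuous_on UNIV turnout_dist"
    unfolding turnout_dist_def by (intro continuous_intros)
  then have "continuous_on {\<tau>. feasible \<tau>} turnout_dist"
    by (rule continuous_on_subset) simp
  moreover have "{\<tau>. feasible \<tau>} \<noteq> {}"
    using feasible_one by blast
  ultimately obtain \<tau> where
    "feasible \<tau>" "\<And>\<tau>'. feasible \<tau>' \<Longrightarrow> turnout_dist \<tau> \<le> turnout_dist \<tau>'"
    using continuous_attains_inf[OF compact_feasible] by blast
  then have "is_arg_min turnout_dist feasible \<tau>"
    by (simp add: is_arg_min_linorder)
  then have "is_arg_min turnout_dist feasible (THE \<tau>. is_arg_min turnout_dist feasible \<tau>)"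
    using minimizer_unique by (metis (no_types) the_equality)
  moreover have "(THE \<tau>. is_arg_min turnout_dist feasible \<tau>) = t\<sigma>"
    by (simp add: sigma_turnout_def turnout_dist_def[abs_def])
  ultimately show ?thesis
    by (simp add: is_arg_min_def)
qed


subsection \<open>Projected scores\<close>

abbreviation u\<pi> :: "'a \<Rightarrow> real" where "u\<pi> \<equiv> upper_score A v \<xi>"
abbreviation l\<pi> :: "'a \<Rightarrow> real" where "l\<pi> \<equiv> lower_score A v \<xi>"
abbreviation P :: "'a \<Rightarrow> 'a \<Rightarrow> real" where "P \<equiv> projected_score A v \<xi>"

text \<open>With \<open>t\<close> and \<open>m\<close> the turnout and margin of the consecutive
  pair, all follow from \<open>0 \<le> m \<le> t \<le> 1\<close>. The bound \<open>1 / 2\<close>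
  later shows that a projected score \<open>1\<close> can only point forward along
  \<open>\<xi>\<close>.\<close>

lemma elementary_score_bounds:
  assumes "x \<in> Domain \<xi>"
  shows "u\<pi> x \<le> 1" "0 \<le> l\<pi> x" "l\<pi> x \<le> 1 / 2" "u\<pi> x + l\<pi> x \<le> 1"
  using feasible_nxt[OF feasible_sigma_turnout assms] sigma_margin_bounds[OF assms]
  by (auto simp: upper_score_def lower_score_def field_simps)

text \<open>The left ends of the consecutive pairs from \<open>x\<close> to \<open>y\<close>, hence
  half-open.\<close>

definition between :: "'a \<Rightarrow> 'a \<Rightarrow> 'a set" where
  "between x y = {p. (x, p) \<in> \<xi>\<^sup>= \<and> (p, y) \<in> \<xi>}"

lemma between:
  assumes "(x, y) \<in> \<xi>"
  shows finite_between: "finite (between x y)" and between_nonempty: "between x y \<noteq> {}"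
    and between_Domain: "p \<in> between x y \<Longrightarrow> p \<in> Domain \<xi>"
proof -
  show "finite (between x y)"
    by (rule finite_subset[OF _ finite_A]) (use ordD in \<open>auto simp: between_def\<close>)
qed (use assms in \<open>auto simp: between_def\<close>)

lemma projected_score_upper: "(x, y) \<in> \<xi> \<Longrightarrow> P x y = Max (u\<pi> ` between x y)"
  by (simp add: projected_score_def between_def)

lemma projected_score_lower: "(x, y) \<in> \<xi> \<Longrightarrow> P y x = Min (l\<pi> ` between x y)"
  using ord_asym by (simp add: projected_score_def between_def)

lemma upper_le_projected: "(x, y) \<in> \<xi> \<Longrightarrow> p \<in> between x y \<Longrightarrow> u\<pi> p \<le> P x y"
  by (simp add: projected_score_upper finite_between)

lemma projected_le_lower: "(x, y) \<in> \<xi> \<Longrightarrow> p \<in> between x y \<Longrightarrow> P y x \<le> l\<pi> p"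
  by (simp add: projected_score_lower finite_between)

lemma projected_upper_attained:
  assumes "(x, y) \<in> \<xi>"
  obtains p where "p \<in> between x y" "P x y = u\<pi> p"
proof -
  have "P x y \<in> u\<pi> ` between x y"
    unfolding projected_score_upper[OF assms]
    using between[OF assms] by (intro Max_in) auto
  then show thesis
    using that by auto
qed

lemma projected_lower_attained:
  assumes "(x, y) \<in> \<xi>"
  obtains p where "p \<in> between x y" "P y x = l\<pi> p"
proof -
  have "P y x \<in> l\<pi> ` between x y"
    unfolding projected_score_lower[OF assms]
    using between[OF assms] by (intro Min_in) auto
  then show thesis
    using that by auto
qed

lemma projected_forward_le_1: "(x, y) \<in> \<xi> \<Longrightarrow> P x y \<le> 1"
  using projected_upper_attained between_Domain elementary_score_bounds by metis

lemma projected_backward_bounds: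
  assumes "(x, y) \<in> \<xi>"
  shows "0 \<le> P y x" "P y x \<le> 1 / 2"
proof -
  obtain p where "p \<in> between x y" "P y x = l\<pi> p"
    using projected_lower_attained[OF assms] .
  then show "0 \<le> P y x" "P y x \<le> 1 / 2"
    using elementary_score_bounds[OF between_Domain[OF assms]] by auto
qed

lemma projected_le_1:
  assumes "x \<in> A" "y \<in> A" "x \<noteq> y"
  shows "P x y \<le> 1"
  using ord_total[OF assms] projected_forward_le_1 projected_backward_bounds(2)[of y x]
  by fastforce

text \<open>At the \<open>p\<close> where the forward maximum is attained, the backward minimum is
  at most \<open>l\<pi> p\<close>, and \<open>u\<pi> p + l\<pi> p \<le> 1\<close>.\<close>

lemma projected_turnout_le_1:
  assumes "x \<in> A" "y \<in> A" "x \<noteq> y"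
  shows "P x y + P y x \<le> 1"
proof -
  have *: "P x y + P y x \<le> 1" if xy: "(x, y) \<in> \<xi>" for x y
  proof -
    obtain p where p: "p \<in> between x y" "P x y = u\<pi> p"
      using projected_upper_attained[OF xy] .
    then show ?thesis
      using projected_le_lower[OF xy p(1)] elementary_score_bounds[OF between_Domain[OF xy p(1)]]
      by linarith
  qed
  show ?thesis
    using ord_total[OF assms] *[of x y] *[of y x] by linarith
qed

text \<open>Dually, at the \<open>p\<close> where the backward minimum is attained, the forward
  maximum is at least \<open>u\<pi> p = 1 - l\<pi> p\<close>.\<close>

lemma projected_turnout_eq_1:
  assumes xy: "(x, y) \<in> \<xi>" and eq: "\<And>p. p \<in> between x y \<Longrightarrow> t\<sigma> p (nxt p) = 1"
  shows "P x y + P y x = 1"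
proof -
  obtain p where p: "p \<in> between x y" "P y x = l\<pi> p"
    using projected_lower_attained[OF xy] .
  have "l\<pi> p + u\<pi> p = 1"
    using eq[OF p(1)] by (simp add: upper_score_def lower_score_def field_simps)
  then have "P x y + P y x \<ge> 1"
    using p upper_le_projected[OF xy p(1)] by linarith
  then show ?thesis
    using projected_turnout_le_1[of x y] ordD[OF xy] by force
qed

section \<open>The sum of the rates over a block\<close>

text \<open>Each row sum is split at the border of \<open>X\<close>, and within \<open>X\<close>
  every score is paired with its reverse. With \<open>n = card X\<close>, the constant is
  \<open>n * n - n * (n - 1) / 2\<close>. Both correction sums are non-negative, which makes the
  equality case rigid.\<close>

lemma sum_rank_like_rate:
  assumes "X \<subseteq> A"
  shows "(\<Sum>x\<in>X. rank_like_rate A v \<xi> x) =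
    real (card X) * (real (card X) + 1) / 2
      + (\<Sum>x\<in>X. \<Sum>y\<in>A - X. 1 - P x y)
      + (\<Sum>x\<in>X. \<Sum>y\<in>X - {x}. 1 - P x y - P y x) / 2"
proof -
  let ?n = "real (card X)"
  have fin: "finite X" "finite (A - X)"
    using assms finite_A by (auto intro: finite_subset)
  have card_A: "real (card A) = ?n + real (card (A - X))"
    using assms finite_A fin by (simp add: card_Diff_subset card_mono of_nat_diff)
  have rate: "rank_like_rate A v \<xi> x =
      ?n + (\<Sum>y\<in>A - X. 1 - P x y) - (\<Sum>y\<in>X - {x}. P x y)" if "x \<in> X" for x
  proof -
    have "(\<Sum>y\<in>A - {x}. P x y) = (\<Sum>y\<in>A - X. P x y) + (\<Sum>y\<in>X - {x}. P x y)"
      using that assms fin by (subst sum.union_disjoint[symmetric]) (auto intro: sum.cong)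
    then show ?thesis
      by (simp add: rank_like_rate_def card_A sum_subtractf)
  qed
  \<comment> \<open>The inner range depends on \<open>x\<close>; taking the diagonal out as a
    separate sum leaves independent ranges, which can be exchanged.\<close>
  have swap: "(\<Sum>x\<in>X. \<Sum>y\<in>X - {x}. P y x) = (\<Sum>x\<in>X. \<Sum>y\<in>X - {x}. P x y)"
    using fin by (simp add: sum_diff1 sum_subtractf sum.swap[of "\<lambda>x y. P y x"])
  have turnouts: "(\<Sum>x\<in>X. \<Sum>y\<in>X - {x}. 1 - P x y - P y x) =
      (\<Sum>x\<in>X. \<Sum>y\<in>X - {x}. 1) - 2 * (\<Sum>x\<in>X. \<Sum>y\<in>X - {x}. P x y)"
    by (simp add: sum_subtractf swap)
  have "(\<Sum>x\<in>X. \<Sum>y\<in>X - {x}. 1) = ?n * (?n - 1)"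
  proof (cases "X = {}")
    case False
    then have "card X \<ge> 1" using fin by (simp add: Suc_le_eq card_gt_0_iff)
    then show ?thesis using fin by (simp add: of_nat_diff)
  qed auto
  moreover have "(\<Sum>x\<in>X. rank_like_rate A v \<xi> x) =
      ?n * ?n + (\<Sum>x\<in>X. \<Sum>y\<in>A - X. 1 - P x y) - (\<Sum>x\<in>X. \<Sum>y\<in>X - {x}. P x y)"
    by (subst sum.cong[OF refl rate]) (simp_all add: sum.distrib sum_subtractf)
  ultimately show ?thesis
    by (simp only: turnouts) (simp add: field_simps)
qed


subsection \<open>Splitting the options into two blocks\<close>

text \<open>\<open>b\<close> is the last element of \<open>X\<close>. The two characterizations
  match the ranges of \<open>p\<close> and \<open>q\<close> in \<open>sigma_margin\<close>, so that
  \<open>m\<sigma> b\<close> is the least margin from \<open>X\<close> to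
  \<open>A - X\<close>.\<close>

lemma border_exists:
  assumes "X \<subseteq> A" "X \<noteq> {}" "A - X \<noteq> {}" "\<And>x y. x \<in> X \<Longrightarrow> y \<in> A - X \<Longrightarrow> (x, y) \<in> \<xi>"
  obtains b where "b \<in> X" "b \<in> Domain \<xi>" "nxt b \<in> A - X"
    "\<And>x. x \<in> X \<longleftrightarrow> (x, b) \<in> \<xi>\<^sup>=" "\<And>y. y \<in> A - X \<longleftrightarrow> (nxt b, y) \<in> \<xi>\<^sup>="
proof -
  obtain b where b: "b \<in> X" "\<And>u. (b, u) \<in> \<xi> \<Longrightarrow> u \<notin> X"
    using wfE_min[OF wf_ord_converse, of _ X] assms(2) by (metis converse_iff equals0I)
  obtain y where y: "y \<in> A - X"
    using assms(3) by blast
  have b_y: "(b, y) \<in> \<xi>"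
    using assms(4) b y by blast
  have nb: "(b, nxt b) \<in> \<xi>" "nxt b \<in> A - X"
    using nxt_greater[OF b_y] b ordD by auto
  have 1: "x \<in> X \<longleftrightarrow> (x, b) \<in> \<xi>\<^sup>=" for x
    using b assms ord_total[of x b] ordD[of x b] ord_asym[of x b] by blast
  have 2: "y \<in> A - X \<longleftrightarrow> (nxt b, y) \<in> \<xi>\<^sup>=" for y
  proof
    show "(nxt b, y) \<in> \<xi>\<^sup>=" if "y \<in> A - X"
      using nxt_least assms(4) b that by blast
    show "y \<in> A - X" if "(nxt b, y) \<in> \<xi>\<^sup>="
      using that nb b(2) ord_trans ordD by blast
  qed
  show thesis
    using that[OF b(1) _ nb(2) 1 2] nb(1) by blast
qed

lemma indirect_comparison_imp_ord:
  assumes "x \<in> A" "y \<in> A" "x \<noteq> y" "indirect_margin A v x y > 0"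
  shows "(x, y) \<in> \<xi>"
  using admissible assms
  by (auto simp: admissible_order_def indirect_comparison_def pairs_def)

lemma unanimous_imp_sum_rates:
  assumes "X \<subseteq> A" "X \<noteq> {}" "A - X \<noteq> {}"
    and un: "\<And>x y. x \<in> X \<Longrightarrow> y \<in> A - X \<Longrightarrow> v x y = 1"
  shows "\<And>x y. x \<in> X \<Longrightarrow> y \<in> A - X \<Longrightarrow> v y x = 0"
    and "(\<Sum>x\<in>X. rank_like_rate A v \<xi> x) = real (card X) * (real (card X) + 1) / 2"
proof -
  show zero: "v y x = 0" if "x \<in> X" "y \<in> A - X" for x y
    using un[OF that] entry_bounds[of x y] entry_bounds[of y x] that assms(1) by force
  have margin: "indirect_margin A v x y = 1" if "x \<in> X" "y \<in> A - X" for x y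
  proof -
    have "x \<in> A" "y \<in> A" "x \<noteq> y" using that assms(1) by auto
    then have "indirect_score A v x y = 1"
      using entry_le_indirect[of x y] indirect_score_bounds[of x y] un[OF that] by simp
    then show ?thesis
      using indirect_score_eq_0[OF assms(1) zero that] by (simp add: indirect_margin_def)
  qed
  have ord: "(x, y) \<in> \<xi>" if "x \<in> X" "y \<in> A - X" for x y
    using that assms(1) margin[OF that] by (intro indirect_comparison_imp_ord) auto
  obtain b where b: "b \<in> X" "b \<in> Domain \<xi>" "nxt b \<in> A - X"
    "\<And>x. x \<in> X \<longleftrightarrow> (x, b) \<in> \<xi>\<^sup>=" "\<And>y. y \<in> A - X \<longleftrightarrow> (nxt b, y) \<in> \<xi>\<^sup>="
    using border_exists[OF assms(1-3) ord] by metis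
  have "1 \<le> m\<sigma> b"
    using margin b(4,5) unfolding le_sigma_margin_iff[OF b(2)] by (metis order_refl)
  then have "m\<sigma> b = 1"
    using sigma_margin_bounds[OF b(2)] by simp
  then have tb: "t\<sigma> b (nxt b) = 1"
    using feasible_nxt[OF feasible_sigma_turnout b(2)] by simp
  \<comment> \<open>Replacing \<open>b\<close> by the earlier \<open>x\<close>, and then
    \<open>nxt b\<close> by the earlier \<open>nxt x\<close>, can only raise the turnout, which is
    already \<open>1\<close> at the border.\<close>
  have turnout: "t\<sigma> x (nxt x) = 1" if "x \<in> X" for x
  proof -
    have x: "(x, nxt b) \<in> \<xi>"
      using ord that b(3) by blast
    have "1 \<le> t\<sigma> x (nxt b)"
      using tb feasible_mono[OF feasible_sigma_turnout, of x b "nxt b"] b(2,4) that Domain_nxt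
      by auto
    then show ?thesis
      using feasible_le_nxt[OF feasible_sigma_turnout x]
        feasible_nxt[OF feasible_sigma_turnout, of x] x by fastforce
  qed
  have XY: "P x y = 1" if "x \<in> X" "y \<in> A - X" for x y
  proof -
    \<comment> \<open>The border pair is among those over which the forward maximum is taken, and
      its upper score is \<open>1\<close>.\<close>
    have "b \<in> between x y"
      using ord[OF b(1) that(2)] b(4) that(1) by (auto simp: between_def)
    moreover have "u\<pi> b = 1"
      using tb \<open>m\<sigma> b = 1\<close> by (simp add: upper_score_def)
    ultimately show ?thesis
      using upper_le_projected projected_forward_le_1 ord[OF that] by (metis antisym)
  qed
  have XX: "P x y + P y x = 1" if "x \<in> X" "y \<in> X" "x \<noteq> y" for x y
  proof -
    have *: "P x y + P y x = 1" if "(x, y) \<in> \<xi>" "y \<in> X" for x y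
    proof (rule projected_turnout_eq_1[OF that(1)])
      fix p assume "p \<in> between x y"
      then have "(p, b) \<in> \<xi>"
        using b(4)[of y] that ord_trans by (auto simp: between_def)
      then show "t\<sigma> p (nxt p) = 1"
        using turnout b(4) by blast
    qed
    show ?thesis
      using ord_total[of x y] *[of x y] *[of y x] that assms(1) by (auto simp: add.commute)
  qed
  have "1 - P x y - P y x = 0" if "x \<in> X" "y \<in> X - {x}" for x y
    using XX[of x y] that by auto
  then show "(\<Sum>x\<in>X. rank_like_rate A v \<xi> x) = real (card X) * (real (card X) + 1) / 2"
    using XY by (simp add: sum_rank_like_rate[OF assms(1)])
qed

lemma sum_rates_imp_margin:
  assumes "X \<subseteq> A" "X \<noteq> {}" "A - X \<noteq> {}"
    and sum: "(\<Sum>x\<in>X. rank_like_rate A v \<xi> x) = real (card X) * (real (card X) + 1) / 2"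
    and xy: "x \<in> X" "y \<in> A - X"
  shows "indirect_margin A v x y = 1"
proof -
  let ?B = "\<Sum>x\<in>X. \<Sum>y\<in>A - X. 1 - P x y"
  have fin: "finite X" "finite (A - X)"
    using assms finite_A by (auto intro: finite_subset)
  have nonneg: "0 \<le> 1 - P x y" if "x \<in> X" "y \<in> A - X" for x y
    using projected_le_1[of x y] that assms(1) by auto
  have "0 \<le> (\<Sum>x\<in>X. \<Sum>y\<in>X - {x}. 1 - P x y - P y x)"
  proof (intro sum_nonneg)
    fix x y assume "x \<in> X" "y \<in> X - {x}"
    then show "0 \<le> 1 - P x y - P y x"
      using projected_turnout_le_1[of x y] assms(1) by (auto simp: algebra_simps)
  qed
  moreover have "0 \<le> ?B"
    by (intro sum_nonneg nonneg)
  ultimately have "?B = 0"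
    using sum unfolding sum_rank_like_rate[OF assms(1)] by linarith
  then have "\<forall>x\<in>X. (\<Sum>y\<in>A - X. 1 - P x y) = 0"
    using fin by (subst (asm) sum_nonneg_eq_0_iff) (auto intro!: sum_nonneg nonneg)
  then have XY: "P x y = 1" if "x \<in> X" "y \<in> A - X" for x y
    using that fin nonneg sum_nonneg_eq_0_iff[of "A - X" "\<lambda>y. 1 - P x y"] by auto
  \<comment> \<open>Backward scores are at most \<open>1 / 2\<close>, so a score \<open>1\<close>
    determines the direction.\<close>
  have ord: "(x, y) \<in> \<xi>" if "x \<in> X" "y \<in> A - X" for x y
    using XY[OF that] projected_backward_bounds(2)[of y x] ord_total[of x y] that assms(1)
    by fastforce
  obtain b where b: "b \<in> X" "b \<in> Domain \<xi>" "nxt b \<in> A - X"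
    "\<And>x. x \<in> X \<longleftrightarrow> (x, b) \<in> \<xi>\<^sup>=" "\<And>y. y \<in> A - X \<longleftrightarrow> (nxt b, y) \<in> \<xi>\<^sup>="
    using border_exists[OF assms(1-3) ord] by metis
  have "(b, nxt b) \<in> \<xi>"
    using ord b by blast
  then obtain p where p: "p \<in> between b (nxt b)" "P b (nxt b) = u\<pi> p"
    using projected_upper_attained by metis
  \<comment> \<open>Nothing lies strictly between \<open>b\<close> and its successor, so the maximum
    has a single term.\<close>
  have "p = b"
    using p(1) nxt_least ord_asym by (auto simp: between_def)
  then have "u\<pi> b = 1"
    using p XY b by auto
  \<comment> \<open>The turnout and the margin add up to \<open>2\<close>, and the turnout is at
    most \<open>1\<close>.\<close>
  then have "1 \<le> m\<sigma> b"
    using feasible_nxt[OF feasible_sigma_turnout b(2)] by (simp add: upper_score_def)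
  then have "1 \<le> indirect_margin A v x y"
    using le_sigma_margin_iff[OF b(2)] b(4,5) xy by blast
  then show ?thesis
    using indirect_margin_le_1[of x y] xy assms(1) by force
qed

end


subsection \<open>Transitive votes\<close>

lemma aggregates_llull:
  assumes "aggregates A K \<alpha> w v"
  shows "llull_matrix A v"
proof -
  have K: "\<And>k. k \<in> K \<Longrightarrow> \<alpha> k > 0" "sum \<alpha> K = 1" "\<And>k. k \<in> K \<Longrightarrow> llull_matrix A (w k)"
    using assms by (auto simp: aggregates_def)
  have bounds: "0 \<le> v x y" "v x y + v y x \<le> 1" if "(x, y) \<in> pairs A" for x y
  proof -
    have yx: "(y, x) \<in> pairs A"
      using that by (auto simp: pairs_def)
    have v: "v x y = (\<Sum>k\<in>K. \<alpha> k * w k x y)" "v y x = (\<Sum>k\<in>K. \<alpha> k * w k y x)"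
      using assms that yx by (auto simp: aggregates_def)
    have w: "0 \<le> w k x y" "w k x y + w k y x \<le> 1" if "k \<in> K" for k
      using K(3)[OF that] \<open>(x, y) \<in> pairs A\<close> by (auto simp: llull_matrix_def)
    show "0 \<le> v x y"
      unfolding v using K(1) w by (intro sum_nonneg) (simp add: less_imp_le)
    have "v x y + v y x = (\<Sum>k\<in>K. \<alpha> k * (w k x y + w k y x))"
      by (simp add: v sum.distrib distrib_left)
    also have "\<dots> \<le> (\<Sum>k\<in>K. \<alpha> k * 1)"
      using K(1) w by (intro sum_mono mult_left_mono) (auto simp: less_imp_le)
    finally show "v x y + v y x \<le> 1"
      using K(2) by simp
  qed
  have "v x y \<le> 1" if "(x, y) \<in> pairs A" for x y
    using bounds[OF that] bounds(1)[of y x] that by (auto simp: pairs_def)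
  with bounds show ?thesis
    by (auto simp: llull_matrix_def)
qed

text \<open>The weights sum to \<open>1\<close>, so the weighted deficits
  \<open>\<alpha> k * (1 - w k x y)\<close> sum to \<open>0\<close>. They are non-negative and the
  weights are positive, so every deficit vanishes.\<close>

lemma aggregates_eq_1:
  assumes "aggregates A K \<alpha> w v" "(x, y) \<in> pairs A" "v x y = 1" "k \<in> K"
  shows "w k x y = 1"
proof -
  have K: "finite K" "\<And>k. k \<in> K \<Longrightarrow> \<alpha> k > 0" "sum \<alpha> K = 1"
    "v x y = (\<Sum>k\<in>K. \<alpha> k * w k x y)"
    using assms(1,2) by (auto simp: aggregates_def)
  have le: "w k x y \<le> 1" if "k \<in> K" for k
    using assms(1,2) that by (fastforce simp: aggregates_def llull_matrix_def)
  have "(\<Sum>k\<in>K. \<alpha> k * (1 - w k x y)) = 0"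
    using K(3,4) assms(3) by (simp add: right_diff_distrib sum_subtractf)
  moreover have "0 \<le> \<alpha> k * (1 - w k x y)" if "k \<in> K" for k
    using K(2)[OF that] le[OF that] by simp
  ultimately have "\<alpha> k * (1 - w k x y) = 0"
    using K(1) assms(4) sum_nonneg_eq_0_iff[of K "\<lambda>k. \<alpha> k * (1 - w k x y)"] by blast
  then show ?thesis
    using K(2)[OF assms(4)] by simp
qed

lemma aggregates_eq_0:
  assumes "aggregates A K \<alpha> w v" "(x, y) \<in> pairs A" "v x y = 0" "k \<in> K"
  shows "w k x y = 0"
proof -
  have K: "finite K" "\<And>k. k \<in> K \<Longrightarrow> \<alpha> k > 0" "(\<Sum>k\<in>K. \<alpha> k * w k x y) = 0"
    using assms(1-3) by (auto simp: aggregates_def)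
  have "0 \<le> w k x y" if "k \<in> K" for k
    using assms(1,2) that by (fastforce simp: aggregates_def llull_matrix_def)
  then have "0 \<le> \<alpha> k * w k x y" if "k \<in> K" for k
    using K(2)[OF that] that by simp
  then have "\<alpha> k * w k x y = 0"
    using K(1,3) assms(4) sum_nonneg_eq_0_iff[of K "\<lambda>k. \<alpha> k * w k x y"] by blast
  then show ?thesis
    using K(2)[OF assms(4)] by simp
qed

text \<open>\<open>transitive_relation\<close> yields nothing when the two ends coincide. If the
  path is back at its start, the induction therefore begins afresh with the next step.\<close>

lemma transitive_relation_path:
  assumes "transitive_relation \<rho>" "\<And>i. Suc i < length p \<Longrightarrow> (p ! i, p ! Suc i) \<in> \<rho>"
    and "n < length p" "p ! 0 \<noteq> p ! n"
  shows "(p ! 0, p ! n) \<in> \<rho>"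
  using assms(3,4)
proof (induction n)
  case (Suc n)
  then have "(p ! n, p ! Suc n) \<in> \<rho>" "p ! 0 = p ! n \<or> (p ! 0, p ! n) \<in> \<rho>"
    using assms(2) by auto
  with Suc.prems(2) assms(1) show ?case
    unfolding transitive_relation_def by metis
qed auto

text \<open>Both halves of the margin matter: the forward score \<open>1\<close> puts
  \<open>(x, y)\<close> into every vote's relation, and the backward score \<open>0\<close> rules
  out that this is a tie.\<close>

lemma transitive_votes_margin:
  assumes agg: "aggregates A K \<alpha> w v" and tr: "transitive_votes A K w"
    and "finite A" and xy: "x \<in> A" "y \<in> A" "x \<noteq> y"
    and margin: "indirect_margin A v x y = 1"
    and adm: "admissible_order A v \<xi>"
  shows "v x y = 1"
proof -
  interpret admissible_llull A v \<xi>
    using assms aggregates_llull by unfold_locales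
  have score: "indirect_score A v x y = 1" "indirect_score A v y x = 0"
    using margin indirect_score_bounds[of x y] indirect_score_bounds[of y x] xy
    by (auto simp: indirect_margin_def)
  then have "v y x = 0"
    using entry_le_indirect[of y x] entry_bounds[of y x] xy by force
  obtain p where p: "is_path A x y p" "path_score v p = 1"
    using indirect_score_attained[OF xy] score(1) by metis
  have "w k x y = 1" if k: "k \<in> K" for k
  proof -
    obtain \<rho> where \<rho>: "transitive_relation \<rho>"
      "\<And>a b. (a, b) \<in> pairs A \<Longrightarrow> w k a b = rel_vote \<rho> a b"
      using tr k unfolding transitive_votes_def by fast
    have "(p ! i, p ! Suc i) \<in> \<rho>" if "Suc i < length p" for i
    proof -
      have pr: "(p ! i, p ! Suc i) \<in> pairs A"
        using is_path_step[OF p(1)] that by simp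
      have "1 \<le> v (p ! i) (p ! Suc i)"
        using le_path_score_iff[OF p(1), of 1 v] p(2) that by simp
      then have "v (p ! i) (p ! Suc i) = 1"
        using pr entry_bounds by (force simp: pairs_def)
      then have "rel_vote \<rho> (p ! i) (p ! Suc i) = 1"
        using aggregates_eq_1[OF agg pr _ k] \<rho>(2)[OF pr] by simp
      then show ?thesis
        by (auto simp: rel_vote_def split: if_splits)
    qed
    moreover have ends: "p ! 0 = x" "p ! (length p - 1) = y" "length p \<ge> 2"
      using is_path_ends[OF p(1)] .
    ultimately have "(x, y) \<in> \<rho>"
      using transitive_relation_path[OF \<rho>(1), of p "length p - 1"] xy(3) by auto
    \<comment> \<open>A tie would contribute \<open>1 / 2\<close> to the reverse entry, which is
      \<open>0\<close> in every vote because \<open>v y x = 0\<close>.\<close>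
    moreover have "rel_vote \<rho> y x = 0"
      using aggregates_eq_0[OF agg _ \<open>v y x = 0\<close> k] \<rho>(2)[of y x] xy by (simp add: pairs_def)
    ultimately have "rel_vote \<rho> x y = 1"
      by (auto simp: rel_vote_def split: if_splits)
    then show ?thesis
      using \<rho>(2)[of x y] xy by (simp add: pairs_def)
  qed
  moreover have "v x y = (\<Sum>k\<in>K. \<alpha> k * w k x y)" "sum \<alpha> K = 1"
    using agg xy by (auto simp: aggregates_def pairs_def)
  ultimately show ?thesis
    by simp
qed

theorem theorem7p2:
  fixes A X Y :: "'a set"
    and K :: "'k set"
    and \<alpha> :: "'k \<Rightarrow> real"
    and w :: "'k \<Rightarrow> 'a \<Rightarrow> 'a \<Rightarrow> real"
    and v :: "'a \<Rightarrow> 'a \<Rightarrow> real"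
    and \<xi> :: "('a \<times> 'a) set"
  assumes "finite A"
    and "A = X \<union> Y" "X \<inter> Y = {}" "X \<noteq> {}" "Y \<noteq> {}"
    and "aggregates A K \<alpha> w v"
    and "admissible_order A v \<xi>"
  shows "((\<forall>x\<in>X. \<forall>y\<in>Y. v x y = 1) \<longrightarrow>
           (\<forall>x\<in>X. \<forall>y\<in>Y. v y x = 0) \<and>
           (\<Sum>x\<in>X. rank_like_rate A v \<xi> x) = real (card X) * (real (card X) + 1) / 2) \<and>
         (transitive_votes A K w \<longrightarrow>
           (\<Sum>x\<in>X. rank_like_rate A v \<xi> x) = real (card X) * (real (card X) + 1) / 2 \<longrightarrow>
           (\<forall>x\<in>X. \<forall>y\<in>Y. v x y = 1))"
proof -
  interpret admissible_llull A v \<xi>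
    using assms aggregates_llull by unfold_locales
  have Y: "Y = A - X" and X: "X \<subseteq> A" "X \<noteq> {}" "A - X \<noteq> {}"
    using assms(2-5) by auto
  show ?thesis
  proof (intro conjI impI ballI)
    assume "\<forall>x\<in>X. \<forall>y\<in>Y. v x y = 1"
    then have un: "\<And>x y. x \<in> X \<Longrightarrow> y \<in> A - X \<Longrightarrow> v x y = 1"
      by (simp add: Y)
    show "v y x = 0" if "x \<in> X" "y \<in> Y" for x y
      using unanimous_imp_sum_rates(1)[OF X un] that by (simp add: Y)
    show "(\<Sum>x\<in>X. rank_like_rate A v \<xi> x) = real (card X) * (real (card X) + 1) / 2"
      using unanimous_imp_sum_rates(2)[OF X un] .
  next
    fix x y
    assume tr: "transitive_votes A K w"
      and sum: "(\<Sum>x\<in>X. rank_like_rate A v \<xi> x) = real (card X) * (real (card X) + 1) / 2"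
      and xy: "x \<in> X" "y \<in> Y"
    have "indirect_margin A v x y = 1"
      using sum_rates_imp_margin[OF X sum] xy by (simp add: Y)
    then show "v x y = 1"
      using transitive_votes_margin[OF assms(6) tr assms(1) _ _ _ _ assms(7)] xy assms(2,3)
      by blast
  qed
qed

end
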